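(* For $k \ge 2$ and $n$ even, if $F_1, F_2, \ldots, F_k$ are $1$-factors on a common set of $n$ vertices, then \[ \gamma_{\rm sd}(F_1,F_2,\ldots,F_k) \le \begin{cases} \left( \dfrac{k-1}{k} \right) n & \text{if } k \text{ is even}, \\[2mm] \left( \dfrac{k}{k+1} \right) n & \text{if } k \text{ is odd}, \end{cases} \] and these bounds are sharp; that is, for every $k \ge 2$ there exist an even $n \geq 2$ and $1$-factors $F_1,\ldots,F_k$ on a common set of $n$ vertices for which equality holds.
   Context: All graphs are finite and simple. A $1$-factor on $n$ vertices is a $1$-regular graph on the $n$ vertices, i.e. a disjoint union of $n/2$ copies of $K_2$. Given graphs $F_1,\ldots,F_k$ (not necessarily edge-disjoint, and not necessarily distinct) with common vertex set $V$, a set $S \subseteq V$ is a simultaneous dominating set if for every $i$, $1 \le i \le k$, every vertex not in $S$ is adjacent in $F_i$ to some vertex of $S$. The simultaneous domination number $\gamma_{\rm sd}(F_1,\ldots,F_k)$ is the minimum cardinality of a simultaneous dominating set. *)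

theory Defs
  imports Complex_Main "Graph_Theory.Pair_Digraph"
begin

text \<open>
  A finite simple graph is a \<^locale>\<open>pair_graph\<close>: each edge \<open>uv\<close> is stored as the two arcs
  \<open>(u, v)\<close> and \<open>(v, u)\<close>, so \<^const>\<open>out_degree\<close> is the ordinary degree and the library relation
  \<open>u \<rightarrow>\<^bsub>G\<^esub> v\<close> is adjacency.
\<close>

definition one_factor :: "'a set \<Rightarrow> 'a pair_pre_digraph \<Rightarrow> bool" where
  "one_factor V F \<longleftrightarrow> pair_graph F \<and> pverts F = V \<and> (\<forall>v\<in>V. out_degree (with_proj F) v = 1)"

definition simultaneous_dominating_set ::
    "'a set \<Rightarrow> 'a pair_pre_digraph list \<Rightarrow> 'a set \<Rightarrow> bool" where
  "simultaneous_dominating_set V Fs S \<longleftrightarrow>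
     S \<subseteq> V \<and> (\<forall>F\<in>set Fs. \<forall>v\<in>V - S. \<exists>s\<in>S. v \<rightarrow>\<^bsub>with_proj F\<^esub> s)"

text \<open>
  For finite \<open>V\<close> the minimum is attained, since \<open>V\<close> itself is a simultaneous dominating set.
  For infinite \<open>V\<close> the value is meaningless, because \<^const>\<open>card\<close> is then 0 on infinite sets.
\<close>

definition sd_number :: "'a set \<Rightarrow> 'a pair_pre_digraph list \<Rightarrow> nat" where
  "sd_number V Fs = (LEAST m. \<exists>S. simultaneous_dominating_set V Fs S \<and> card S = m)"

definition sd_bound :: "nat \<Rightarrow> nat \<Rightarrow> real" where
  "sd_bound k n =
     (if even k then ((real k - 1) / real k) * real n
      else (real k / (real k + 1)) * real n)"

end

theory Submission
  imports Defs
begin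

text \<open>
  The complement of a simultaneous dominating set is an independent set of the union graph, so the
  task is to find an independent set of size at least \<open>n/(k+1)\<close>, respectively \<open>n/k\<close>. The first comes
  from a greedy colouring with \<open>k + 1\<close> colours. For even \<open>k\<close> the following parity argument replaces
  Brooks' theorem. A component \<open>D\<close> has even order, and deleting one vertex of \<open>D\<close> leaves a
  \<open>(k-1)\<close>-degenerate graph, which is \<open>k\<close>-colourable. Some colour class \<open>I\<close> then satisfies
  \<open>k |I| \<ge> |D| - 1\<close>, and since \<open>k |I|\<close> is even and \<open>|D| - 1\<close> is odd, \<open>k |I| \<ge> |D|\<close>.
  Sharpness is witnessed by a 1-factorization of the complete graph on \<open>k + 1\<close> (\<open>k\<close> odd) or
  \<open>k\<close> (\<open>k\<close> even) vertices, one factor being repeated in the latter case.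
\<close>

section \<open>Colouring degenerate graphs\<close>

text \<open>Set aside a vertex \<open>u\<close> with fewer than \<open>m\<close> neighbours in
  \<open>W\<close> and colour the rest by induction; some colour is then missing among those
  neighbours and is free for \<open>u\<close>. The degree hypothesis ranges over all subsets
  \<open>U\<close>, so it passes to \<open>W - {u}\<close>.\<close>

lemma degenerate_colouring:
  fixes adj :: "'a \<Rightarrow> 'a \<Rightarrow> bool"
  assumes "finite W"
    and sym: "\<And>x y. adj x y \<Longrightarrow> adj y x" and irrefl: "\<And>x. \<not> adj x x"
    and "\<And>U. U \<subseteq> W \<Longrightarrow> U \<noteq> {} \<Longrightarrow> \<exists>u\<in>U. card {w \<in> U. adj u w} < m"
  shows "\<exists>c. c ` W \<subseteq> {..<m} \<and> (\<forall>x\<in>W. \<forall>y\<in>W. adj x y \<longrightarrow> c x \<noteq> (c y :: nat))"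
  using assms(1,4)
proof (induction W rule: finite_psubset_induct)
  case (psubset W)
  show ?case
  proof (cases "W = {}")
    case False
    then obtain u where u: "u \<in> W" "card {w \<in> W. adj u w} < m"
      using psubset.prems[of W] by auto
    have "\<exists>c. c ` (W - {u}) \<subseteq> {..<m} \<and>
        (\<forall>x\<in>W - {u}. \<forall>y\<in>W - {u}. adj x y \<longrightarrow> c x \<noteq> (c y :: nat))"
      by (rule psubset.IH) (use u psubset.prems in auto)
    then obtain c :: "'a \<Rightarrow> nat" where c: "c ` (W - {u}) \<subseteq> {..<m}"
      "\<And>x y. x \<in> W - {u} \<Longrightarrow> y \<in> W - {u} \<Longrightarrow> adj x y \<Longrightarrow> c x \<noteq> c y"
      by blast
    have "card (c ` {w \<in> W. adj u w}) < card {..<m}"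
      using u(2) card_image_le[of "{w \<in> W. adj u w}" c] psubset.hyps by simp
    then have "\<not> {..<m} \<subseteq> c ` {w \<in> W. adj u w}"
      using card_mono[of "c ` {w \<in> W. adj u w}" "{..<m}"] psubset.hyps by auto
    then obtain a where a: "a < m" "a \<notin> c ` {w \<in> W. adj u w}" by auto
    have "(c(u := a)) ` W \<subseteq> {..<m}"
      using c(1) a(1) by auto
    moreover have "(c(u := a)) x \<noteq> (c(u := a)) y" if xy: "x \<in> W" "y \<in> W" "adj x y" for x y
    proof -
      have "x \<noteq> y" using xy(3) irrefl by blast
      consider "x = u" | "y = u" | "x \<noteq> u" "y \<noteq> u" by blast
      then show ?thesis
        using xy \<open>x \<noteq> y\<close> a(2) c(2)[of x y] sym[OF xy(3)] by cases auto
    qed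
    ultimately show ?thesis by blast
  qed auto
qed

text \<open>By pigeonhole, a largest colour class of an \<open>m\<close>-colouring contains at least
  a fraction 1/\<open>m\<close> of \<open>W\<close>.\<close>

lemma degenerate_independent_set:
  fixes adj :: "'a \<Rightarrow> 'a \<Rightarrow> bool"
  assumes fin: "finite W" and "m > 0"
    and "\<And>x y. adj x y \<Longrightarrow> adj y x" and "\<And>x. \<not> adj x x"
    and "\<And>U. U \<subseteq> W \<Longrightarrow> U \<noteq> {} \<Longrightarrow> \<exists>u\<in>U. card {w \<in> U. adj u w} < m"
  obtains I where "I \<subseteq> W" "\<forall>x\<in>I. \<forall>y\<in>I. \<not> adj x y" "card W \<le> m * card I"
proof -
  obtain c :: "'a \<Rightarrow> nat" where c: "c ` W \<subseteq> {..<m}" "\<forall>x\<in>W. \<forall>y\<in>W. adj x y \<longrightarrow> c x \<noteq> c y"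
    using degenerate_colouring[of W adj m] assms by blast
  have "\<exists>i\<in>{..<m}. card W \<le> card (c -` {i} \<inter> W) * card {..<m}"
    by (rule pigeonhole_card) (use c(1) fin \<open>m > 0\<close> in auto)
  then obtain i where "card W \<le> m * card (c -` {i} \<inter> W)" by (auto simp: mult.commute)
  with c(2) that[of "c -` {i} \<inter> W"] show thesis by auto
qed

section \<open>1-factors as fixed-point-free involutions\<close>

lemma even_card_involution:
  assumes "finite A"
    and "\<And>x. x \<in> A \<Longrightarrow> g x \<in> A \<and> g x \<noteq> x \<and> g (g x) = x"
  shows "even (card A)"
  using assms
proof (induction A rule: finite_psubset_induct)
  case (psubset A)
  show ?case
  proof (cases "A = {}")
    case False
    then obtain x where x: "x \<in> A" by blast
    have gx: "g x \<in> A" "g x \<noteq> x" using psubset.prems x by auto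
    have "even (card (A - {x, g x}))"
    proof (rule psubset.IH)
      show "A - {x, g x} \<subset> A" using x by blast
      show "g y \<in> A - {x, g x} \<and> g y \<noteq> y \<and> g (g y) = y" if "y \<in> A - {x, g x}" for y
        using that psubset.prems x by (metis Diff_iff insert_iff singletonD)
    qed
    moreover have "card A = card (A - {x, g x}) + 2"
      using card_Diff_subset[of "{x, g x}" A] card_mono[of A "{x, g x}"] x gx psubset.hyps by auto
    ultimately show ?thesis by simp
  qed simp
qed

text \<open>Out-degree 1 makes adjacency the graph of a function \<open>g\<close>; symmetry of the
  arcs makes \<open>g\<close> an involution, and the absence of loops makes it
  fixed-point-free.\<close>

lemma one_factor_partner:
  assumes "one_factor V F"
  obtains g where "\<And>v. v \<in> V \<Longrightarrow> g v \<in> V \<and> g v \<noteq> v \<and> g (g v) = v"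
    and "\<And>u v. (u, v) \<in> parcs F \<longleftrightarrow> u \<in> V \<and> v = g u"
proof -
  interpret pair_graph F using assms by (simp add: one_factor_def)
  have V: "pverts F = V" using assms by (simp add: one_factor_def)
  have "\<exists>w. \<forall>w'. (v, w') \<in> parcs F \<longleftrightarrow> w' = w" if v: "v \<in> V" for v
  proof -
    have "card {e \<in> parcs F. fst e = v} = 1"
      using assms v by (simp add: one_factor_def out_degree_def out_arcs_def)
    then obtain e where e: "{e \<in> parcs F. fst e = v} = {e}" by (auto simp: card_1_singleton_iff)
    then have "\<forall>w'. (v, w') \<in> parcs F \<longleftrightarrow> w' = snd e"
      by (metis (mono_tags, lifting) fst_conv snd_conv mem_Collect_eq prod.collapse singleton_iff)
    then show ?thesis by blast
  qed
  then obtain g where g: "\<And>v w. v \<in> V \<Longrightarrow> (v, w) \<in> parcs F \<longleftrightarrow> w = g v" by metis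
  have arc: "(u, v) \<in> parcs F \<Longrightarrow> u \<in> V \<and> v \<in> V \<and> u \<noteq> v \<and> (v, u) \<in> parcs F" for u v
    using in_arcsD1 in_arcsD2 pair_no_loops[of "(u, v)"] pair_sym_arcs V
    by (auto simp: symmetric_def dest: symD)
  show thesis
    by (rule that[of g]) (use g arc in metis)+
qed


section \<open>Independent sets of the union graph and the upper bound\<close>

lemma sd_number_le:
  assumes "simultaneous_dominating_set V Fs S"
  shows "sd_number V Fs \<le> card S"
  unfolding sd_number_def using assms by (intro Least_le) blast

lemma sd_number_attained:
  obtains S where "simultaneous_dominating_set V Fs S" "card S = sd_number V Fs"
proof -
  have "\<exists>m S. simultaneous_dominating_set V Fs S \<and> card S = m"
    by (intro exI[of _ "card V"] exI[of _ V]) (simp add: simultaneous_dominating_set_def)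
  from LeastI_ex[OF this] that show thesis unfolding sd_number_def by blast
qed

definition union_adj :: "'a pair_pre_digraph list \<Rightarrow> 'a \<Rightarrow> 'a \<Rightarrow> bool" where
  "union_adj Fs u v \<longleftrightarrow> (\<exists>F\<in>set Fs. (u, v) \<in> parcs F)"

context
  fixes V :: "'a set" and Fs :: "'a pair_pre_digraph list"
  assumes fin: "finite V" and factors: "\<And>F. F \<in> set Fs \<Longrightarrow> one_factor V F"
begin

lemma union_adj_sym: "union_adj Fs u v \<Longrightarrow> union_adj Fs v u"
  unfolding union_adj_def by (metis factors one_factor_partner)

lemma union_adj_irrefl: "\<not> union_adj Fs u u"
  unfolding union_adj_def by (metis factors one_factor_partner)

lemma union_adj_verts: "union_adj Fs u v \<Longrightarrow> u \<in> V \<and> v \<in> V"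
  unfolding union_adj_def by (metis factors one_factor_partner)

text \<open>Each factor contributes at most one neighbour of \<open>u\<close>, so the union graph
  has maximum degree at most \<open>length Fs\<close>, also when factors repeat or share
  edges.\<close>

lemma union_adj_neighbours:
  shows "finite {v. union_adj Fs u v}" and "card {v. union_adj Fs u v} \<le> length Fs"
proof -
  have "\<forall>F\<in>set Fs. \<exists>g. \<forall>u v. (u, v) \<in> parcs F \<longrightarrow> v = g u"
    by (metis factors one_factor_partner)
  then obtain g where "\<forall>F\<in>set Fs. \<forall>u v. (u, v) \<in> parcs F \<longrightarrow> v = g F u" by metis
  then have sub: "{v. union_adj Fs u v} \<subseteq> (\<lambda>F. g F u) ` set Fs"
    by (auto simp: union_adj_def)
  then show "finite {v. union_adj Fs u v}" by (rule finite_subset) simp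
  have "card {v. union_adj Fs u v} \<le> card ((\<lambda>F. g F u) ` set Fs)"
    using sub by (intro card_mono) auto
  also have "\<dots> \<le> length Fs"
    using card_image_le[of "set Fs" "\<lambda>F. g F u"] card_length[of Fs] by simp
  finally show "card {v. union_adj Fs u v} \<le> length Fs" .
qed

text \<open>In every factor the partner of a vertex of \<open>I\<close> lies outside
  \<open>I\<close>, so \<open>V - I\<close> is a simultaneous dominating set.\<close>

lemma sd_number_independent_set:
  assumes "I \<subseteq> V" and "\<forall>x\<in>I. \<forall>y\<in>I. \<not> union_adj Fs x y"
  shows "sd_number V Fs + card I \<le> card V"
proof -
  have "\<exists>s\<in>V - I. (v, s) \<in> parcs F" if F: "F \<in> set Fs" and v: "v \<in> I" for F v
  proof -
    obtain s where s: "s \<in> V" "(v, s) \<in> parcs F"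
      using F v factors assms(1) by (metis one_factor_partner subsetD)
    with F v assms(2) show ?thesis by (auto simp: union_adj_def)
  qed
  then have "simultaneous_dominating_set V Fs (V - I)"
    using assms(1) by (auto simp: simultaneous_dominating_set_def)
  from sd_number_le[OF this] show ?thesis
    using card_Diff_subset[of I V] card_mono[of V I] assms(1) fin finite_subset[of I V] by simp
qed

lemma independent_set_greedy:
  obtains I where "I \<subseteq> V" "\<forall>x\<in>I. \<forall>y\<in>I. \<not> union_adj Fs x y"
    "card V \<le> (length Fs + 1) * card I"
proof (rule degenerate_independent_set[OF fin, of "length Fs + 1" "union_adj Fs"])
  show "\<exists>u\<in>U. card {w \<in> U. union_adj Fs u w} < length Fs + 1" if "U \<noteq> {}" for U
  proof -
    obtain u where u: "u \<in> U" using \<open>U \<noteq> {}\<close> by blast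
    have "card {w \<in> U. union_adj Fs u w} \<le> card {w. union_adj Fs u w}"
      by (intro card_mono union_adj_neighbours) auto
    with u union_adj_neighbours(2)[of u] show ?thesis
      by (intro bexI[of _ u]) simp_all
  qed
qed (use that union_adj_sym union_adj_irrefl in auto)

text \<open>For subsets of \<open>V\<close> this says: a union of components of the union graph.
  Components then appear as minimal nonempty closed sets, without any notion of path.\<close>

definition union_closed :: "'a set \<Rightarrow> bool" where
  "union_closed D \<longleftrightarrow> (\<forall>u\<in>D. \<forall>v. union_adj Fs u v \<longrightarrow> v \<in> D)"

lemma independent_set_component:
  assumes "even (length Fs)" "Fs \<noteq> []"
    and D: "D \<subseteq> V" "D \<noteq> {}" "union_closed D"
    and minimal: "\<And>U. U \<subset> D \<Longrightarrow> U \<noteq> {} \<Longrightarrow> \<not> union_closed U"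
  obtains I where "I \<subseteq> D" "\<forall>x\<in>I. \<forall>y\<in>I. \<not> union_adj Fs x y" "card D \<le> length Fs * card I"
proof -
  have finD: "finite D" using D(1) fin by (rule finite_subset)
  obtain F where F: "F \<in> set Fs" using \<open>Fs \<noteq> []\<close> by (meson list.set_sel(1))
  obtain g where g: "\<And>v. v \<in> V \<Longrightarrow> g v \<in> V \<and> g v \<noteq> v \<and> g (g v) = v"
    "\<And>u v. (u, v) \<in> parcs F \<longleftrightarrow> u \<in> V \<and> v = g u"
    using one_factor_partner[OF factors[OF F]] by blast
  have "even (card D)"
  proof (rule even_card_involution[OF finD])
    show "g x \<in> D \<and> g x \<noteq> x \<and> g (g x) = x" if "x \<in> D" for x
    proof -
      have "x \<in> V" using that D(1) by blast
      then have "union_adj Fs x (g x)" using g(2) F by (auto simp: union_adj_def)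
      with that D(3) g(1)[OF \<open>x \<in> V\<close>] show ?thesis by (auto simp: union_closed_def)
    qed
  qed
  obtain v where v: "v \<in> D" using D(2) by blast
  have "\<exists>I. I \<subseteq> D - {v} \<and> (\<forall>x\<in>I. \<forall>y\<in>I. \<not> union_adj Fs x y) \<and>
      card (D - {v}) \<le> length Fs * card I"
  proof (rule degenerate_independent_set[of "D - {v}" "length Fs" "union_adj Fs"])
    show "\<exists>u\<in>U. card {w \<in> U. union_adj Fs u w} < length Fs"
      if U: "U \<subseteq> D - {v}" "U \<noteq> {}" for U
    proof -
      \<comment> \<open>Deleting \<open>v\<close> makes every \<open>U\<close> a proper subset of
        the component, so some edge leaves \<open>U\<close> and its end \<open>u\<close> has lost a
        neighbour.\<close>
      have "U \<subset> D" using U v by blast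
      from minimal[OF this U(2)] obtain u w where uw: "u \<in> U" "w \<notin> U" "union_adj Fs u w"
        by (auto simp: union_closed_def)
      have "card {w \<in> U. union_adj Fs u w} < card {w. union_adj Fs u w}"
        by (intro psubset_card_mono union_adj_neighbours) (use uw in blast)
      with uw(1) union_adj_neighbours(2)[of u] show ?thesis
        by (intro bexI[of _ u]) simp_all
    qed
  qed (use finD assms(2) union_adj_sym union_adj_irrefl in auto)
  then obtain I where I: "I \<subseteq> D - {v}" "\<forall>x\<in>I. \<forall>y\<in>I. \<not> union_adj Fs x y"
    "card (D - {v}) \<le> length Fs * card I"
    by blast
  have "card D - 1 \<le> length Fs * card I" using I(3) v by simp
  \<comment> \<open>Parity gains the missing 1: the left side is even, the right side odd.\<close>
  moreover have "card D \<noteq> Suc (length Fs * card I)"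
    using \<open>even (card D)\<close> \<open>even (length Fs)\<close> by auto
  ultimately have "card D \<le> length Fs * card I" by linarith
  with I that[of I] show thesis by blast
qed

text \<open>Components are split off one at a time. No edge joins \<open>D\<close> to
  \<open>C - D\<close>, so the independent sets found in the two pieces combine and their bounds add
  up.\<close>

lemma independent_set_even:
  assumes "even (length Fs)" "Fs \<noteq> []"
    and "C \<subseteq> V" "union_closed C"
  shows "\<exists>I\<subseteq>C. (\<forall>x\<in>I. \<forall>y\<in>I. \<not> union_adj Fs x y) \<and> card C \<le> length Fs * card I"
  using finite_subset[OF \<open>C \<subseteq> V\<close> fin] assms(3,4)
proof (induction C rule: finite_psubset_induct)
  case (psubset C)
  show ?case
  proof (cases "C = {}")
    case False
    let ?P = "\<lambda>D. D \<subseteq> C \<and> D \<noteq> {} \<and> union_closed D"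
    \<comment> \<open>Least cardinality forces minimality under inclusion, so \<open>D\<close> is a
      component.\<close>
    define D where "D = arg_min card ?P"
    have "?P C" using False psubset.prems by blast
    then have D: "D \<subseteq> C" "D \<noteq> {}" "union_closed D"
      using arg_min_natI[of ?P C card] unfolding D_def by blast+
    have finD: "finite D" using D(1) psubset.hyps by (rule finite_subset)
    have minimal: "\<not> union_closed U" if "U \<subset> D" "U \<noteq> {}" for U
    proof
      assume "union_closed U"
      then have "card D \<le> card U"
        using arg_min_nat_le[of ?P U card] that D(1) unfolding D_def by blast
      with psubset_card_mono[OF finD that(1)] show False by simp
    qed
    obtain I where I: "I \<subseteq> D" "\<forall>x\<in>I. \<forall>y\<in>I. \<not> union_adj Fs x y" "card D \<le> length Fs * card I"
      using independent_set_component[OF assms(1,2) _ D(2,3) minimal] D(1) psubset.prems(1) by blast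
    have "union_closed (C - D)"
      using psubset.prems(2) D(3) union_adj_sym unfolding union_closed_def by blast
    then obtain J where J: "J \<subseteq> C - D" "\<forall>x\<in>J. \<forall>y\<in>J. \<not> union_adj Fs x y"
      "card (C - D) \<le> length Fs * card J"
      using psubset.IH[of "C - D"] psubset.prems(1) D(1,2) by blast
    have "card (I \<union> J) = card I + card J"
      using I(1) J(1) finD psubset.hyps by (intro card_Un_disjoint) (auto dest: finite_subset)
    moreover have "card C = card D + card (C - D)"
      using card_Diff_subset[OF finD D(1)] card_mono[OF psubset.hyps D(1)] by simp
    ultimately have "card C \<le> length Fs * card (I \<union> J)"
      using I(3) J(3) by (simp add: algebra_simps)
    moreover have "\<forall>x\<in>I \<union> J. \<forall>y\<in>I \<union> J. \<not> union_adj Fs x y"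
      using I(1,2) J(1,2) D(3) union_adj_sym unfolding union_closed_def by blast
    moreover have "I \<union> J \<subseteq> C" using I(1) J(1) D(1) by blast
    ultimately show ?thesis by blast
  qed auto
qed

lemma sd_number_le_bound:
  assumes "Fs \<noteq> []"
  shows "real (sd_number V Fs) \<le> sd_bound (length Fs) (card V)"
proof -
  \<comment> \<open>With this \<open>m\<close> both cases of the bound read (\<open>m\<close> -
    1)/\<open>m\<close> times \<open>card V\<close>.\<close>
  define m where "m = (if even (length Fs) then length Fs else length Fs + 1)"
  have "m > 0" using assms by (simp add: m_def)
  have "\<exists>I\<subseteq>V. (\<forall>x\<in>I. \<forall>y\<in>I. \<not> union_adj Fs x y) \<and> card V \<le> m * card I"
  proof (cases "even (length Fs)")
    case True
    have "union_closed V" using union_adj_verts by (auto simp: union_closed_def)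
    with independent_set_even[OF True assms subset_refl] True show ?thesis by (simp add: m_def)
  next
    case False
    show ?thesis by (rule independent_set_greedy) (use False in \<open>auto simp: m_def\<close>)
  qed
  then obtain I where I: "I \<subseteq> V" "\<forall>x\<in>I. \<forall>y\<in>I. \<not> union_adj Fs x y" "card V \<le> m * card I"
    by blast
  have "m * (sd_number V Fs + card I) \<le> m * card V"
    using sd_number_independent_set[OF I(1,2)] by (rule mult_le_mono2)
  with I(3) have "m * sd_number V Fs + card V \<le> m * card V"
    by (simp add: distrib_left)
  then have "real (m * sd_number V Fs + card V) \<le> real (m * card V)"
    by (simp only: of_nat_le_iff)
  then have "real (sd_number V Fs) * real m \<le> (real m - 1) * real (card V)"
    by (simp add: algebra_simps)
  then have "real (sd_number V Fs) \<le> (real m - 1) / real m * real (card V)"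
    using \<open>m > 0\<close> by (simp add: field_simps)
  then show ?thesis by (auto simp: sd_bound_def m_def add.commute split: if_splits)
qed

end

section \<open>Sharpness via round-robin 1-factorizations\<close>

text \<open>
  The round-robin 1-factorization of the complete graph on \<open>{0..p}\<close> for odd \<open>p\<close>, where the vertex \<open>p\<close>
  plays the role of the point at infinity: it takes the missing partner of \<open>i\<close> when \<open>2i\<close> is
  congruent to the colour.
\<close>

definition rr_colour :: "nat \<Rightarrow> nat \<Rightarrow> nat \<Rightarrow> nat" where
  "rr_colour p i j = ((if i = p then j else i) + (if j = p then i else j)) mod p"

definition rr_factor :: "nat \<Rightarrow> nat \<Rightarrow> nat pair_pre_digraph" where
  "rr_factor p r = \<lparr> pverts = {..p},
     parcs = {(i, j). i \<le> p \<and> j \<le> p \<and> i \<noteq> j \<and> rr_colour p i j = r} \<rparr>"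

text \<open>For finite \<open>i\<close> the congruence \<open>i + j\<close> = \<open>r\<close>
  modulo \<open>p\<close> has one solution \<open>j\<close>, replaced by \<open>p\<close> when it is
  \<open>i\<close> itself. For \<open>i = p\<close> the congruence \<open>2 * j\<close> =
  \<open>r\<close> has one solution because \<open>p\<close> is odd.\<close>

lemma rr_partner:
  assumes "odd p" "r < p" "i \<le> p"
  shows "\<exists>!j. j \<le> p \<and> i \<noteq> j \<and> rr_colour p i j = r"
proof -
  \<comment> \<open>The sums inside \<open>rr_colour\<close> stay below \<open>2 * p\<close>, so
    congruences become a choice between two linear equations.\<close>
  have mod_iff: "x mod p = r \<longleftrightarrow> x = r \<or> x = r + p" if "x < 2 * p" for x
    using that \<open>r < p\<close> by (auto simp: mod_if)
  have colour: "rr_colour p i j = r \<longleftrightarrow>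
      (if i = p then 2 * j = r \<or> 2 * j = r + p
       else if j = p then 2 * i = r \<or> 2 * i = r + p
       else i + j = r \<or> i + j = r + p)"
    if "j \<le> p" "i \<noteq> j" for j
    using that \<open>i \<le> p\<close> by (auto simp: rr_colour_def mod_iff mult_2)
  define w where "w =
    (if i = p then if even r then r div 2 else (r + p) div 2
     else if 2 * i = r \<or> 2 * i = r + p then p
     else if i \<le> r then r - i else r + p - i)"
  show ?thesis
  proof (rule ex1I[of _ w])
    have "w \<le> p" "i \<noteq> w" using assms by (auto simp: w_def)
    moreover have "if i = p then 2 * w = r \<or> 2 * w = r + p
       else if w = p then 2 * i = r \<or> 2 * i = r + p
       else i + w = r \<or> i + w = r + p"
      using assms by (auto simp: w_def)
    ultimately show "w \<le> p \<and> i \<noteq> w \<and> rr_colour p i w = r" using colour by blast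
    show "j = w" if "j \<le> p \<and> i \<noteq> j \<and> rr_colour p i j = r" for j
    proof -
      have "if i = p then 2 * j = r \<or> 2 * j = r + p
        else if j = p then 2 * i = r \<or> 2 * i = r + p
        else i + j = r \<or> i + j = r + p"
        using that colour by blast
      moreover have "j \<le> p" "i \<noteq> j" using that by auto
      \<comment> \<open>The parity of \<open>r\<close> decides which of the two equations can hold
        at the point at infinity.\<close>
      moreover have "2 * j = r \<longrightarrow> even r" by auto
      moreover have "2 * j = r + p \<longrightarrow> odd r" using assms(1) by (metis dvd_triv_left even_add)
      ultimately show ?thesis using assms(2,3) by (auto simp: w_def split: if_splits)
    qed
  qed
qed

lemma one_factor_rr_factor:
  assumes "odd p" "r < p"
  shows "one_factor {..p} (rr_factor p r)"
proof -
  have sym: "rr_colour p i j = rr_colour p j i" for i j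
    by (simp add: rr_colour_def add.commute)
  have "finite (parcs (rr_factor p r))"
    by (rule finite_subset[of _ "{..p} \<times> {..p}"]) (auto simp: rr_factor_def)
  then have "pair_graph (rr_factor p r)"
    by unfold_locales
      (auto simp: rr_factor_def sym symmetric_def intro!: symI)
  moreover have "out_degree (with_proj (rr_factor p r)) i = 1" if i: "i \<le> p" for i
  proof -
    have "(i, j) \<in> parcs (rr_factor p r) \<longleftrightarrow> j \<le> p \<and> i \<noteq> j \<and> rr_colour p i j = r" for j
      using i by (simp add: rr_factor_def)
    then have "\<exists>!j. (i, j) \<in> parcs (rr_factor p r)"
      using rr_partner[OF assms i] by (simp only:)
    then obtain j where j: "(i, j) \<in> parcs (rr_factor p r)"
      "\<And>j'. (i, j') \<in> parcs (rr_factor p r) \<Longrightarrow> j' = j"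
      by blast
    have "{e \<in> parcs (rr_factor p r). fst e = i} = {(i, j)}"
    proof (intro equalityI subsetI)
      fix e assume "e \<in> {e \<in> parcs (rr_factor p r). fst e = i}"
      then show "e \<in> {(i, j)}" using j(2)[of "snd e"] by (cases e) simp
    qed (use j(1) in simp)
    then show ?thesis by (simp add: out_degree_def out_arcs_def)
  qed
  ultimately show ?thesis by (auto simp: one_factor_def rr_factor_def)
qed

text \<open>At most one vertex can lie outside a simultaneous dominating set: if \<open>x\<close>
  and \<open>y\<close> both did, the factor containing the edge \<open>xy\<close> would give
  \<open>x\<close> no partner but \<open>y\<close>.\<close>

lemma sd_number_complete:
  assumes "finite V" and "\<And>F. F \<in> set Fs \<Longrightarrow> one_factor V F"
    and complete: "\<And>u v. u \<in> V \<Longrightarrow> v \<in> V \<Longrightarrow> u \<noteq> v \<Longrightarrow> union_adj Fs u v"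
  shows "card V \<le> sd_number V Fs + 1"
proof -
  obtain S where S: "simultaneous_dominating_set V Fs S" "card S = sd_number V Fs"
    by (rule sd_number_attained)
  have "x = y" if xy: "x \<in> V - S" "y \<in> V - S" for x y
  proof (rule ccontr)
    assume "x \<noteq> y"
    with xy complete obtain F where F: "F \<in> set Fs" "(x, y) \<in> parcs F"
      by (auto simp: union_adj_def)
    with S(1) xy obtain s where "s \<in> S" "(x, s) \<in> parcs F"
      unfolding simultaneous_dominating_set_def with_proj_simps by blast
    with F xy assms(2) show False by (metis DiffD2 one_factor_partner)
  qed
  then have "card (V - S) \<le> 1" using assms(1) card_le_Suc0_iff_eq[of "V - S"] by auto
  moreover have "card V = card S + card (V - S)"
    using S(1) assms(1) card_Diff_subset[of S V] card_mono[of V S] finite_subset[of S V]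
    by (simp add: simultaneous_dominating_set_def)
  ultimately show ?thesis using S(2) by simp
qed

text \<open>The complete graph on \<open>p + 1\<close> vertices splits into \<open>p\<close>
  factors. For odd \<open>k\<close> these are all of \<open>Fs\<close>; for even \<open>k\<close>
  there are only \<open>k - 1\<close>, and \<open>i mod p\<close> repeats factor 0 as the last
  entry.\<close>

lemma sd_bound_sharp:
  assumes "k \<ge> 2"
  defines "p \<equiv> if even k then k - 1 else k"
  defines "Fs \<equiv> map (\<lambda>i. rr_factor p (i mod p)) [0..<k]"
  shows "\<forall>F\<in>set Fs. one_factor {..p} F" and "real (sd_number {..p} Fs) = sd_bound k (p + 1)"
proof -
  have p: "odd p" "p > 0" "p \<le> k" using assms(1) by (auto simp: p_def)
  show factors: "\<forall>F\<in>set Fs. one_factor {..p} F"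
    using p by (auto simp: Fs_def intro: one_factor_rr_factor)
  have "union_adj Fs u v" if "u \<in> {..p}" "v \<in> {..p}" "u \<noteq> v" for u v
  proof -
    let ?r = "rr_colour p u v"
    have "?r < p" using p by (simp add: rr_colour_def)
    then have "rr_factor p ?r \<in> set Fs"
      using p(3) by (auto simp: Fs_def intro!: image_eqI[of _ _ ?r])
    moreover have "(u, v) \<in> parcs (rr_factor p ?r)" using that by (simp add: rr_factor_def)
    ultimately show ?thesis by (auto simp: union_adj_def)
  qed
  then have "real p \<le> real (sd_number {..p} Fs)"
    using sd_number_complete[of "{..p}" Fs] factors by simp
  moreover have "sd_bound k (p + 1) = real p"
    using assms(1) by (auto simp: sd_bound_def p_def field_simps)
  moreover have "real (sd_number {..p} Fs) \<le> sd_bound k (p + 1)"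
    using sd_number_le_bound[of "{..p}" Fs] factors assms(1) by (simp add: Fs_def)
  ultimately show "real (sd_number {..p} Fs) = sd_bound k (p + 1)" by simp
qed

theorem theorem21:
  fixes k :: nat
  assumes "k \<ge> 2"
  shows "(\<forall>n (V :: 'a set) Fs.
            even n \<and> finite V \<and> card V = n \<and> length Fs = k \<and> (\<forall>F\<in>set Fs. one_factor V F)
              \<longrightarrow> real (sd_number V Fs) \<le> sd_bound k n)
       \<and> (\<exists>n (V :: nat set) Fs.
            even n \<and> n \<ge> 2 \<and> finite V \<and> card V = n \<and> length Fs = k \<and> (\<forall>F\<in>set Fs. one_factor V F)
              \<and> real (sd_number V Fs) = sd_bound k n)"
proof (intro conjI allI impI, goal_cases)
  case (1 n V Fs)
  then have "Fs \<noteq> []" using assms by auto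
  with 1 sd_number_le_bound[of V Fs] show ?case by blast
next
  case 2
  let ?p = "if even k then k - 1 else k"
  let ?Fs = "map (\<lambda>i. rr_factor ?p (i mod ?p)) [0..<k]"
  show ?case
    using sd_bound_sharp[OF assms] assms
    by (intro exI[of _ "?p + 1"] exI[of _ "{..?p}"] exI[of _ ?Fs]) auto
qed

end
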